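(* Let $H$ be a real Hilbert space and let $A$ be a self-adjoint nonnegative operator on $H$ with dense domain (with $\{e_k\}$, $\lambda_k$, and the spaces $\mathcal{G}_{\varphi,\infty,\alpha}(A)$ and $\mathcal{GM}^{(\beta)}_{\varphi,\{\rho_n\},\alpha}(A)$ as described in the context). Let $\varphi:[0,+\infty)\to(0,+\infty)$ be any function, and let $$(u_0,u_1)\in\mathcal{G}_{\varphi,\infty,3/4}(A)\times\mathcal{G}_{\varphi,\infty,1/4}(A).$$ Then for every $\beta\geq 0$ there exist sequences $\{\overline{\rho}_n\}$ and $\{\widehat{\rho}_n\}$ in $\mathcal{L}$, and $$(\overline{u}_0,\overline{u}_1)\in\mathcal{GM}^{(\beta)}_{\varphi,\{\overline{\rho}_n\},3/4}(A)\times\mathcal{GM}^{(\beta)}_{\varphi,\{\overline{\rho}_n\},1/4}(A),$$ $$(\widehat{u}_0,\widehat{u}_1)\in\mathcal{GM}^{(\beta)}_{\varphi,\{\widehat{\rho}_n\},3/4}(A)\times\mathcal{GM}^{(\beta)}_{\varphi,\{\widehat{\rho}_n\},1/4}(A),$$ such that $u_0=\overline{u}_0+\widehat{u}_0$ and $u_1=\overline{u}_1+\widehat{u}_1$.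
   Context: Hilbert space setting. $H$ is a real Hilbert space with norm $|x|$ and scalar product $\langle x,y\rangle$. $A$ is an unbounded linear operator on $H$ with dense domain $D(A)$, self-adjoint and nonnegative. It is assumed that $H$ admits a countable complete orthonormal system $\{e_k\}_{k\geq 1}$ made of eigenvectors of $A$, with $Ae_k=\lambda_k^2e_k$ and $\lambda_k\geq 0$. For $u\in H$ write $u_k=\langle u,e_k\rangle$, so $u=\sum_{k\ge1} u_ke_k$. Spaces. For $\varphi:[0,+\infty)\to(0,+\infty)$, $\alpha\geq 0$, $r>0$, set $$\|u\|_{\varphi,r,\alpha}^2:=\sum_{k=1}^\infty\lambda_k^{4\alpha}u_k^2\exp\big(r\varphi(\lambda_k)\big),\qquad \mathcal{G}_{\varphi,r,\alpha}(A):=\{u\in H:\|u\|_{\varphi,r,\alpha}^2<+\infty\},$$ $$\mathcal{G}_{\varphi,\infty,\alpha}(A):=\bigcap_{r>0}\mathcal{G}_{\varphi,r,\alpha}(A).$$ Let $\mathcal{L}$ be the set of all sequences $\{\rho_n\}_{n\in\mathbb{N}}$ of positive real numbers with $\rho_n\to+\infty$. For $\{\rho_n\}\in\mathcal{L}$, $\alpha\geq 0$, $\beta\geq 0$, set $$\mathcal{GM}^{(\beta)}_{\varphi,\{\rho_n\},\alpha}(A):=\Big\{u\in H:\sum_{\lambda_k>\rho_n}\lambda_k^{4\alpha}u_k^2\exp\big(\rho_n^\beta\varphi(\lambda_k)\big)\leq\rho_n\quad\forall n\in\mathbb{N}\Big\},$$ where the sum is over all indices $k$ with $\lambda_k>\rho_n$.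 *)

theory Defs
  imports "HOL-Analysis.Analysis"
begin

text \<open>
  An unbounded operator on a Hilbert space \<open>H\<close> (a type of class \<open>real_inner\<close> and
  \<open>complete_space\<close>) is a pair of a domain \<open>D :: H set\<close> and a function \<open>A :: H \<Rightarrow> H\<close>;
  the values of \<open>A\<close> outside \<open>D\<close> are irrelevant.
\<close>

definition densely_defined_operator :: "'a::real_inner set \<Rightarrow> ('a \<Rightarrow> 'a) \<Rightarrow> bool" where
  "densely_defined_operator D A \<longleftrightarrow>
     subspace D \<and> closure D = UNIV \<and>
     (\<forall>x\<in>D. \<forall>y\<in>D. A (x + y) = A x + A y) \<and>
     (\<forall>c. \<forall>x\<in>D. A (c *\<^sub>R x) = c *\<^sub>R A x)"

text \<open>
  The graph of the adjoint: \<open>y\<close> lies in the domain of the adjoint, with value \<open>z\<close>, iff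
  \<open>A x \<bullet> y = x \<bullet> z\<close> for all \<open>x\<close> in \<open>D\<close>; density of \<open>D\<close> makes \<open>z\<close> unique.
\<close>

definition adjoint_graph :: "'a::real_inner set \<Rightarrow> ('a \<Rightarrow> 'a) \<Rightarrow> ('a \<times> 'a) set" where
  "adjoint_graph D A = {(y, z). \<forall>x\<in>D. A x \<bullet> y = x \<bullet> z}"

text \<open>Equality of graphs includes equality of the domains, so this is more than symmetry.\<close>

definition self_adjoint_operator :: "'a::real_inner set \<Rightarrow> ('a \<Rightarrow> 'a) \<Rightarrow> bool" where
  "self_adjoint_operator D A \<longleftrightarrow>
     densely_defined_operator D A \<and> adjoint_graph D A = (\<lambda>x. (x, A x)) ` D"

definition nonnegative_operator :: "'a::real_inner set \<Rightarrow> ('a \<Rightarrow> 'a) \<Rightarrow> bool" where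
  "nonnegative_operator D A \<longleftrightarrow> (\<forall>x\<in>D. A x \<bullet> x \<ge> 0)"

definition complete_orthonormal_system :: "(nat \<Rightarrow> 'a::real_inner) \<Rightarrow> bool" where
  "complete_orthonormal_system e \<longleftrightarrow>
     (\<forall>j k. e j \<bullet> e k = (if j = k then 1 else 0)) \<and> closure (span (range e)) = UNIV"

text \<open>
  Indices start at \<open>0\<close>; \<open>lam k\<close> is the square root of the eigenvalue belonging to \<open>e k\<close>.
\<close>

definition eigenbasis ::
    "'a::real_inner set \<Rightarrow> ('a \<Rightarrow> 'a) \<Rightarrow> (nat \<Rightarrow> 'a) \<Rightarrow> (nat \<Rightarrow> real) \<Rightarrow> bool" where
  "eigenbasis D A e lam \<longleftrightarrow>
     complete_orthonormal_system e \<and>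
     (\<forall>k. lam k \<ge> 0 \<and> e k \<in> D \<and> A (e k) = (lam k)\<^sup>2 *\<^sub>R e k)"

text \<open>
  Real powers of nonnegative numbers with the convention that \<open>0\<close> to the power \<open>0\<close> is \<open>1\<close>
  (whereas \<open>0 powr 0 = 0\<close>).
\<close>

definition nonneg_powr :: "real \<Rightarrow> real \<Rightarrow> real" where
  "nonneg_powr x a = (if a = 0 then 1 else x powr a)"

text \<open>
  The series below have nonnegative terms and are summed in \<open>ennreal\<close>, so that a divergent
  series has the value \<open>\<infinity>\<close>.
\<close>

definition gevrey_norm_sq ::
    "(nat \<Rightarrow> 'a::real_inner) \<Rightarrow> (nat \<Rightarrow> real) \<Rightarrow> (real \<Rightarrow> real) \<Rightarrow> real \<Rightarrow> real \<Rightarrow> 'a \<Rightarrow> ennreal" where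
  "gevrey_norm_sq e lam \<phi> r \<alpha> u =
     (\<Sum>k. ennreal (nonneg_powr (lam k) (4 * \<alpha>) * (u \<bullet> e k)\<^sup>2 * exp (r * \<phi> (lam k))))"

definition gevrey_space ::
    "(nat \<Rightarrow> 'a::real_inner) \<Rightarrow> (nat \<Rightarrow> real) \<Rightarrow> (real \<Rightarrow> real) \<Rightarrow> real \<Rightarrow> real \<Rightarrow> 'a set" where
  "gevrey_space e lam \<phi> r \<alpha> = {u. gevrey_norm_sq e lam \<phi> r \<alpha> u < \<infinity>}"

definition gevrey_space_inf ::
    "(nat \<Rightarrow> 'a::real_inner) \<Rightarrow> (nat \<Rightarrow> real) \<Rightarrow> (real \<Rightarrow> real) \<Rightarrow> real \<Rightarrow> 'a set" where
  "gevrey_space_inf e lam \<phi> \<alpha> = (\<Inter>r\<in>{0<..}. gevrey_space e lam \<phi> r \<alpha>)"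

definition divergent_sequences :: "(nat \<Rightarrow> real) set" where
  "divergent_sequences = {\<rho>. (\<forall>n. \<rho> n > 0) \<and> filterlim \<rho> at_top sequentially}"

definition gm_space ::
    "(nat \<Rightarrow> 'a::real_inner) \<Rightarrow> (nat \<Rightarrow> real) \<Rightarrow> (real \<Rightarrow> real) \<Rightarrow> real \<Rightarrow> (nat \<Rightarrow> real) \<Rightarrow> real \<Rightarrow> 'a set"
  where
  "gm_space e lam \<phi> \<beta> \<rho> \<alpha> =
     {u. \<forall>n. (\<Sum>\<^sub>\<infinity>k\<in>{k. lam k > \<rho> n}.
                ennreal (nonneg_powr (lam k) (4 * \<alpha>) * (u \<bullet> e k)\<^sup>2 *
                         exp (\<rho> n powr \<beta> * \<phi> (lam k))))
             \<le> ennreal (\<rho> n)}"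

end

(*
  Choose 1 = s 0 < s 1 < ... so fast that the weighted tails over lam k > s (n + 1), with
  weight exponent (s n) powr beta, are at most s n.  Cut u0 and u1 according to the intervals
  (s n, s (n + 1)] containing lam k: the part living on odd n has no components just above
  the even thresholds s (2 n), so its tail beyond s (2 n) is already a tail beyond s (2 n + 1);
  symmetrically, the remaining part works with the odd thresholds.
*)

theory Submission
  imports Defs
begin

lemma infsum_ennreal_le:
  fixes f :: "'b \<Rightarrow> ennreal"
  assumes "\<And>F. finite F \<Longrightarrow> F \<subseteq> S \<Longrightarrow> sum f F \<le> c"
  shows "infsum f S \<le> c"
  unfolding nonneg_infsum_complete[of S f, simplified]
  by (rule SUP_least) (use assms in auto)

text \<open>The values \<open>lam k\<close> come in no particular order, so a threshold on
  \<open>lam k\<close> must be turned into one on \<open>k\<close>: if \<open>T\<close> dominates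
  the first \<open>N\<close> values, every \<open>k\<close> with \<open>lam k > T\<close> lies in
  the tail from \<open>N\<close> on, which summability makes small.\<close>

lemma ennreal_tail_above_threshold:
  fixes f lam :: "nat \<Rightarrow> real"
  assumes nonneg: "\<And>k. f k \<ge> 0"
    and fin: "(\<Sum>k. ennreal (f k)) < \<infinity>"
    and "\<epsilon> > 0"
  obtains T where "\<And>t. t \<ge> T \<Longrightarrow> infsum (\<lambda>k. ennreal (f k)) {k. lam k > t} \<le> ennreal \<epsilon>"
proof -
  have "summable f"
    using fin nonneg by (intro summable_suminf_not_top) auto
  then obtain N where N: "norm (sum f {N..<n}) < \<epsilon>" for n
    using \<open>\<epsilon> > 0\<close> unfolding summable_Cauchy by blast
  \<comment> \<open>Inserting \<open>0\<close> keeps \<open>Max\<close> meaningful when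
    \<open>N = 0\<close>.\<close>
  define T where "T = Max (insert 0 (lam ` {..<N}))"
  have T: "lam k \<le> T" if "k < N" for k
    unfolding T_def using that by (intro Max_ge) auto
  have "infsum (\<lambda>k. ennreal (f k)) {k. lam k > t} \<le> ennreal \<epsilon>" if "t \<ge> T" for t
  proof (rule infsum_ennreal_le)
    fix F assume F: "finite F" "F \<subseteq> {k. lam k > t}"
    \<comment> \<open>For empty \<open>F\<close> the value \<open>Max F\<close> is unspecified, but
      the inclusion is trivial and \<open>N\<close> controls blocks of any length.\<close>
    have "F \<subseteq> {N..<Suc (Max F)}"
    proof
      fix k assume "k \<in> F"
      then have "lam k > T" using F that by force
      then have "k \<ge> N" using T[of k] by fastforce
      moreover have "k \<le> Max F" using \<open>k \<in> F\<close> F by simp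
      ultimately show "k \<in> {N..<Suc (Max F)}" by simp
    qed
    then have "sum f F \<le> sum f {N..<Suc (Max F)}"
      by (intro sum_mono2) (auto simp: nonneg)
    also have "\<dots> \<le> \<epsilon>"
      using N[of "Suc (Max F)"] by simp
    finally show "(\<Sum>k\<in>F. ennreal (f k)) \<le> ennreal \<epsilon>"
      by (simp add: sum_ennreal nonneg ennreal_leI)
  qed
  then show thesis by (rule that)
qed

lemma bessel_inequality:
  fixes e :: "'i \<Rightarrow> 'a::real_inner"
  assumes orth: "\<And>j k. e j \<bullet> e k = (if j = k then 1 else 0)" and "finite F"
  shows "(\<Sum>k\<in>F. (u \<bullet> e k)\<^sup>2) \<le> u \<bullet> u"
proof -
  \<comment> \<open>\<open>p\<close> is the orthogonal projection of \<open>u\<close> onto the span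
    of the chosen vectors; the inequality is the nonnegativity of the squared norm of
    \<open>u - p\<close>.\<close>
  define p where "p = (\<Sum>k\<in>F. (u \<bullet> e k) *\<^sub>R e k)"
  have up: "u \<bullet> p = (\<Sum>k\<in>F. (u \<bullet> e k)\<^sup>2)"
    by (simp add: p_def inner_sum_right power2_eq_square)
  have "p \<bullet> e k = u \<bullet> e k" if "k \<in> F" for k
    using that \<open>finite F\<close>
    by (simp add: p_def inner_sum_left orth if_distrib cong: if_cong)
  then have "p \<bullet> p = (\<Sum>k\<in>F. (u \<bullet> e k)\<^sup>2)"
    by (subst (2) p_def) (simp add: inner_sum_right power2_eq_square)
  then have "(u - p) \<bullet> (u - p) = u \<bullet> u - (\<Sum>k\<in>F. (u \<bullet> e k)\<^sup>2)"
    using up by (simp add: inner_diff_left inner_diff_right inner_commute)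
  then show ?thesis
    by (metis diff_ge_0_iff_ge inner_ge_zero)
qed

lemma norm_sum_orthonormal:
  fixes e :: "'i \<Rightarrow> 'a::real_inner"
  assumes orth: "\<And>j k. e j \<bullet> e k = (if j = k then 1 else 0)" and "finite F"
  shows "(norm (\<Sum>k\<in>F. c k *\<^sub>R e k))\<^sup>2 = (\<Sum>k\<in>F. (c k)\<^sup>2)"
  unfolding power2_norm_eq_inner using \<open>finite F\<close>
  by (simp add: inner_sum_left inner_sum_right orth power2_eq_square if_distrib cong: if_cong)

text \<open>By Pythagoras the squared norm of a block of the vector series is the block of squared
  coefficients, hence the Cauchy criterion at \<epsilon> squared; completeness of the space does the
  rest.\<close>

lemma summable_orthonormal:
  fixes e :: "nat \<Rightarrow> 'a::{real_inner, complete_space}"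
  assumes orth: "\<And>j k. e j \<bullet> e k = (if j = k then 1 else 0)"
    and sq: "summable (\<lambda>k. (c k)\<^sup>2)"
  shows "summable (\<lambda>k. c k *\<^sub>R e k)"
proof -
  have "Cauchy (\<lambda>n. \<Sum>k<n. c k *\<^sub>R e k)"
  proof (rule CauchyI')
    fix \<epsilon> :: real assume "\<epsilon> > 0"
    then obtain N where N: "\<And>m n. m \<ge> N \<Longrightarrow> norm (\<Sum>k\<in>{m..<n}. (c k)\<^sup>2) < \<epsilon>\<^sup>2"
      using sq unfolding summable_Cauchy by (meson zero_less_power)
    have "norm ((\<Sum>k<m. c k *\<^sub>R e k) - (\<Sum>k<n. c k *\<^sub>R e k)) < \<epsilon>"
      if "m \<ge> N" "m < n" for m n
    proof -
      have "{..<n} - {..<m} = {m..<n}" by auto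
      then have "(\<Sum>k<n. c k *\<^sub>R e k) - (\<Sum>k<m. c k *\<^sub>R e k) = (\<Sum>k\<in>{m..<n}. c k *\<^sub>R e k)"
        using \<open>m < n\<close> by (metis finite_lessThan lessThan_subset_iff less_imp_le sum_diff)
      moreover have "(norm (\<Sum>k\<in>{m..<n}. c k *\<^sub>R e k))\<^sup>2 < \<epsilon>\<^sup>2"
        using N[OF \<open>m \<ge> N\<close>, of n] by (simp add: norm_sum_orthonormal[OF orth] sum_nonneg)
      ultimately show ?thesis
        using \<open>\<epsilon> > 0\<close> by (metis norm_minus_commute power2_less_imp_less less_imp_le)
    qed
    then show "\<exists>M. \<forall>m\<ge>M. \<forall>n>m.
        dist (\<Sum>k<m. c k *\<^sub>R e k) (\<Sum>k<n. c k *\<^sub>R e k) < \<epsilon>"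
      by (auto simp: dist_norm)
  qed
  then show ?thesis
    by (simp add: summable_iff_convergent Cauchy_convergent)
qed

text \<open>Bessel makes the retained coefficients square summable, so their series converges, and
  continuity of the inner product reads off its coordinates. This is the projection that cuts
  \<open>u0\<close> and \<open>u1\<close>.\<close>

lemma orthonormal_coordinate_restriction:
  fixes e :: "nat \<Rightarrow> 'a::{real_inner, complete_space}"
  assumes orth: "\<And>j k. e j \<bullet> e k = (if j = k then 1 else 0)"
  obtains v where "\<And>k. v \<bullet> e k = (if k \<in> E then u \<bullet> e k else 0)"
proof -
  define c where "c k = (if k \<in> E then u \<bullet> e k else 0)" for k
  have "summable (\<lambda>k. (c k)\<^sup>2)"
  proof (rule summableI_nonneg_bounded[where x = "u \<bullet> u"])
    fix n
    have "(\<Sum>k<n. (c k)\<^sup>2) \<le> (\<Sum>k<n. (u \<bullet> e k)\<^sup>2)"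
      by (intro sum_mono) (simp add: c_def)
    also have "\<dots> \<le> u \<bullet> u"
      by (rule bessel_inequality[OF orth]) simp
    finally show "(\<Sum>k<n. (c k)\<^sup>2) \<le> u \<bullet> u" .
  qed simp
  then have "(\<lambda>k. c k *\<^sub>R e k) sums (\<Sum>k. c k *\<^sub>R e k)"
    by (intro summable_sums summable_orthonormal[OF orth])
  then have "(\<lambda>k. (c k *\<^sub>R e k) \<bullet> e j) sums ((\<Sum>k. c k *\<^sub>R e k) \<bullet> e j)" for j
    by (rule bounded_linear.sums[OF bounded_linear_inner_left])
  moreover have "(\<lambda>k. (c k *\<^sub>R e k) \<bullet> e j) = (\<lambda>k. if k = j then c k else 0)" for j
    by (auto simp: orth)
  ultimately have "(\<Sum>k. c k *\<^sub>R e k) \<bullet> e j = c j" for j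
    using sums_single[of j c] by (metis (no_types, lifting) sums_unique2)
  then show thesis
    by (intro that[of "\<Sum>k. c k *\<^sub>R e k"]) (simp add: c_def)
qed

text \<open>Since \<open>v\<close> has no components with \<open>lam k\<close> between
  \<open>\<rho> n\<close> and \<open>\<tau> n\<close>, its sum beyond \<open>\<rho> n\<close> is
  dominated by the sum of \<open>u\<close> beyond the later threshold \<open>\<tau> n\<close>, where
  the bound is known.\<close>

lemma gm_space_lacunary:
  assumes coord: "\<And>k. v \<bullet> e k = u \<bullet> e k \<or> v \<bullet> e k = 0"
    and gap: "\<And>n k. \<rho> n < lam k \<Longrightarrow> lam k \<le> \<tau> n \<Longrightarrow> v \<bullet> e k = 0"
    and tail: "\<And>n. infsum (\<lambda>k. ennreal (nonneg_powr (lam k) (4 * \<alpha>) * (u \<bullet> e k)\<^sup>2 *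
        exp (\<rho> n powr \<beta> * \<phi> (lam k)))) {k. lam k > \<tau> n} \<le> ennreal (\<rho> n)"
  shows "v \<in> gm_space e lam \<phi> \<beta> \<rho> \<alpha>"
proof -
  have "infsum (\<lambda>k. ennreal (nonneg_powr (lam k) (4 * \<alpha>) * (v \<bullet> e k)\<^sup>2 *
        exp (\<rho> n powr \<beta> * \<phi> (lam k)))) {k. lam k > \<rho> n} \<le> ennreal (\<rho> n)" (is "?L \<le> _") for n
  proof -
    have "?L \<le> infsum (\<lambda>k. ennreal (nonneg_powr (lam k) (4 * \<alpha>) * (u \<bullet> e k)\<^sup>2 *
        exp (\<rho> n powr \<beta> * \<phi> (lam k)))) {k. lam k > \<tau> n}"
    proof (rule infsum_mono_neutral)
      fix k assume "k \<in> {k. lam k > \<rho> n} \<inter> {k. lam k > \<tau> n}"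
      show "ennreal (nonneg_powr (lam k) (4 * \<alpha>) * (v \<bullet> e k)\<^sup>2 * exp (\<rho> n powr \<beta> * \<phi> (lam k)))
          \<le> ennreal (nonneg_powr (lam k) (4 * \<alpha>) * (u \<bullet> e k)\<^sup>2 * exp (\<rho> n powr \<beta> * \<phi> (lam k)))"
        using coord[of k] by auto
    qed (use gap in \<open>auto intro!: nonneg_summable_on_complete simp: not_less\<close>)
    with tail[of n] show ?thesis by order
  qed
  then show ?thesis by (simp add: gm_space_def)
qed

text \<open>Membership for every positive \<open>r\<close> lets the exponent be prescribed first and
  the threshold chosen afterwards. Allowing all later \<open>t\<close> lets two vectors share one
  threshold.\<close>

lemma gevrey_space_inf_tail:
  assumes u: "u \<in> gevrey_space_inf e lam \<phi> \<alpha>" and "r > 0" "\<epsilon> > 0"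
  obtains T where "\<And>t. t \<ge> T \<Longrightarrow> infsum (\<lambda>k. ennreal (nonneg_powr (lam k) (4 * \<alpha>) *
    (u \<bullet> e k)\<^sup>2 * exp (r * \<phi> (lam k)))) {k. lam k > t} \<le> ennreal \<epsilon>"
proof -
  define f where "f k = nonneg_powr (lam k) (4 * \<alpha>) * (u \<bullet> e k)\<^sup>2 * exp (r * \<phi> (lam k))" for k
  have "f k \<ge> 0" for k
    by (simp add: f_def nonneg_powr_def)
  moreover have "(\<Sum>k. ennreal (f k)) < \<infinity>"
    using u \<open>r > 0\<close>
    by (auto simp: f_def gevrey_space_inf_def gevrey_space_def gevrey_norm_sq_def)
  ultimately obtain T where
    "\<And>t. t \<ge> T \<Longrightarrow> infsum (\<lambda>k. ennreal (f k)) {k. lam k > t} \<le> ennreal \<epsilon>"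
    using ennreal_tail_above_threshold[OF _ _ \<open>\<epsilon> > 0\<close>] by blast
  then show thesis
    by (intro that) (simp add: f_def)
qed

theorem proposition3p2:
  fixes D :: "'a::{real_inner, complete_space} set"
    and A :: "'a \<Rightarrow> 'a"
    and e :: "nat \<Rightarrow> 'a"
    and lam :: "nat \<Rightarrow> real"
    and \<phi> :: "real \<Rightarrow> real"
    and u0 u1 :: 'a
  assumes "self_adjoint_operator D A"
    and "nonnegative_operator D A"
    and "eigenbasis D A e lam"
    and "\<And>x. x \<ge> 0 \<Longrightarrow> \<phi> x > 0"
    and "(u0, u1) \<in> gevrey_space_inf e lam \<phi> (3/4) \<times> gevrey_space_inf e lam \<phi> (1/4)"
  shows "\<forall>\<beta>\<ge>0. \<exists>\<rho>1\<in>divergent_sequences. \<exists>\<rho>2\<in>divergent_sequences.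
           \<exists>(v0, v1) \<in> gm_space e lam \<phi> \<beta> \<rho>1 (3/4) \<times> gm_space e lam \<phi> \<beta> \<rho>1 (1/4).
           \<exists>(w0, w1) \<in> gm_space e lam \<phi> \<beta> \<rho>2 (3/4) \<times> gm_space e lam \<phi> \<beta> \<rho>2 (1/4).
             u0 = v0 + w0 \<and> u1 = v1 + w1"
proof (intro allI impI)
  fix \<beta> :: real
  \<comment> \<open>\<open>x\<close> fixes both the exponent and the bound, as an entry of the
    sequence does in \<open>gm_space\<close>; only the cutoff \<open>y\<close> is separate.\<close>
  define tail where "tail \<alpha> u x y \<longleftrightarrow>
    infsum (\<lambda>k. ennreal (nonneg_powr (lam k) (4 * \<alpha>) * (u \<bullet> e k)\<^sup>2 *
      exp (x powr \<beta> * \<phi> (lam k)))) {k. lam k > y} \<le> ennreal x" for \<alpha> u x y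
  have orth: "e j \<bullet> e k = (if j = k then 1 else 0)" for j k
    using assms(3) by (simp add: eigenbasis_def complete_orthonormal_system_def)
  have "\<exists>y. 0 < y \<and> x + 1 \<le> y \<and> tail (3/4) u0 x y \<and> tail (1/4) u1 x y" if "0 < x" for x
  proof -
    have u: "u0 \<in> gevrey_space_inf e lam \<phi> (3/4)" "u1 \<in> gevrey_space_inf e lam \<phi> (1/4)"
      using assms(5) by auto
    have "x powr \<beta> > 0" using that by simp
    obtain T0 where "\<And>t. t \<ge> T0 \<Longrightarrow> tail (3/4) u0 x t"
      unfolding tail_def using gevrey_space_inf_tail[OF u(1) \<open>x powr \<beta> > 0\<close> \<open>0 < x\<close>] by blast
    moreover obtain T1 where "\<And>t. t \<ge> T1 \<Longrightarrow> tail (1/4) u1 x t"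
      unfolding tail_def using gevrey_space_inf_tail[OF u(2) \<open>x powr \<beta> > 0\<close> \<open>0 < x\<close>] by blast
    ultimately show ?thesis
      using that by (intro exI[of _ "max (x + 1) (max T0 T1)"]) auto
  qed
  \<comment> \<open>Positivity is the invariant of the dependent choice, started at 1; each entry is
    a cutoff for its predecessor only.\<close>
  then obtain s :: "nat \<Rightarrow> real" where s: "\<And>n. 0 < s n" "\<And>n. s n + 1 \<le> s (Suc n)"
    "\<And>n. tail (3/4) u0 (s n) (s (Suc n))" "\<And>n. tail (1/4) u1 (s n) (s (Suc n))"
    using dependent_nat_choice[of "\<lambda>_ x. 0 < x"
        "\<lambda>_ x y. x + 1 \<le> y \<and> tail (3/4) u0 x y \<and> tail (1/4) u1 x y"]
    by (metis zero_less_one)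
  have "real n \<le> s n" for n
  proof (induction n)
    case (Suc n)
    then show ?case using s(2)[of n] by simp
  qed (simp add: less_imp_le s(1))
  then have lim: "filterlim s at_top sequentially"
    by (intro filterlim_at_top_mono[OF filterlim_real_sequentially]) simp
  have "strict_mono s"
    using s(2) by (intro strict_monoI_Suc) (smt (verit))
  then have mono: "s m \<le> s n \<longleftrightarrow> m \<le> n" for m n
    by (rule strict_mono_less_eq)
  \<comment> \<open>The intervals are open on the left to match the strict cutoff in
    \<open>gm_space\<close>.\<close>
  have unique: "m = n" if "s m < x" "x \<le> s (Suc m)" "s n < x" "x \<le> s (Suc n)" for m n x
    using that mono[of "Suc m" n] mono[of "Suc n" m] by (smt (verit) not_less_eq_eq le_antisym)
  define \<rho>1 where "\<rho>1 n = s (2 * n)" for n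
  define \<rho>2 where "\<rho>2 n = s (Suc (2 * n))" for n
  have even: "strict_mono (\<lambda>n::nat. 2 * n)" and odd: "strict_mono (\<lambda>n::nat. Suc (2 * n))"
    by (auto intro!: strict_monoI)
  have "\<rho>1 \<in> divergent_sequences" "\<rho>2 \<in> divergent_sequences"
    using s(1) filterlim_compose[OF lim filterlim_subseq[OF even]]
      filterlim_compose[OF lim filterlim_subseq[OF odd]]
    by (simp_all add: divergent_sequences_def \<rho>1_def[abs_def] \<rho>2_def[abs_def])
  \<comment> \<open>\<open>E\<close> selects the odd intervals. All other indices go to the
    complement, including those with \<open>lam k\<close> at most \<open>s 0\<close>, which lie
    below every cutoff and so enter no condition.\<close>
  define E where "E = {k. \<exists>n. \<rho>2 n < lam k \<and> lam k \<le> s (Suc (Suc (2 * n)))}"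
  have gap: "k \<notin> E" if "\<rho>1 n < lam k" "lam k \<le> s (Suc (2 * n))" for n k
  proof
    assume "k \<in> E"
    then obtain m where "s (Suc (2 * m)) < lam k" "lam k \<le> s (Suc (Suc (2 * m)))"
      by (auto simp: E_def \<rho>2_def)
    \<comment> \<open>\<open>lam k\<close> would lie in an odd and an even interval at once, so
      parity gives the contradiction.\<close>
    then have "Suc (2 * m) = 2 * n"
      using that unfolding \<rho>1_def by (intro unique)
    then show False by presburger
  qed
  obtain v0 where v0: "v0 \<bullet> e k = (if k \<in> E then u0 \<bullet> e k else 0)" for k
    using orthonormal_coordinate_restriction[OF orth] by blast
  obtain v1 where v1: "v1 \<bullet> e k = (if k \<in> E then u1 \<bullet> e k else 0)" for k
    using orthonormal_coordinate_restriction[OF orth] by blast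
  \<comment> \<open>\<open>s(3)\<close> is used at the even index \<open>2 * n\<close>, so exponent
    and bound are those of \<open>\<rho>1 n\<close> and the cutoff is the next entry.\<close>
  have "v0 \<in> gm_space e lam \<phi> \<beta> \<rho>1 (3/4)"
    by (rule gm_space_lacunary[where u = u0 and \<tau> = "\<lambda>n. s (Suc (2 * n))"])
      (use s(3) gap in \<open>auto simp: v0 tail_def \<rho>1_def\<close>)
  moreover have "v1 \<in> gm_space e lam \<phi> \<beta> \<rho>1 (1/4)"
    by (rule gm_space_lacunary[where u = u1 and \<tau> = "\<lambda>n. s (Suc (2 * n))"])
      (use s(4) gap in \<open>auto simp: v1 tail_def \<rho>1_def\<close>)
  moreover have "u0 - v0 \<in> gm_space e lam \<phi> \<beta> \<rho>2 (3/4)"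
  proof (rule gm_space_lacunary[where u = u0 and \<tau> = "\<lambda>n. s (Suc (Suc (2 * n)))"])
    \<comment> \<open>Here the gap is an odd interval, so \<open>k\<close> is in \<open>E\<close> by
      definition and \<open>v0\<close> has the full coordinate of \<open>u0\<close>.\<close>
    show "(u0 - v0) \<bullet> e k = 0" if "\<rho>2 n < lam k" "lam k \<le> s (Suc (Suc (2 * n)))" for n k
      using that by (auto simp: inner_diff_left v0 E_def)
  qed (use s(3) in \<open>auto simp: inner_diff_left v0 tail_def \<rho>2_def\<close>)
  moreover have "u1 - v1 \<in> gm_space e lam \<phi> \<beta> \<rho>2 (1/4)"
  proof (rule gm_space_lacunary[where u = u1 and \<tau> = "\<lambda>n. s (Suc (Suc (2 * n)))"])
    show "(u1 - v1) \<bullet> e k = 0" if "\<rho>2 n < lam k" "lam k \<le> s (Suc (Suc (2 * n)))" for n k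
      using that by (auto simp: inner_diff_left v1 E_def)
  qed (use s(4) in \<open>auto simp: inner_diff_left v1 tail_def \<rho>2_def\<close>)
  ultimately show "\<exists>\<rho>1\<in>divergent_sequences. \<exists>\<rho>2\<in>divergent_sequences.
           \<exists>(v0, v1) \<in> gm_space e lam \<phi> \<beta> \<rho>1 (3/4) \<times> gm_space e lam \<phi> \<beta> \<rho>1 (1/4).
           \<exists>(w0, w1) \<in> gm_space e lam \<phi> \<beta> \<rho>2 (3/4) \<times> gm_space e lam \<phi> \<beta> \<rho>2 (1/4).
             u0 = v0 + w0 \<and> u1 = v1 + w1"
    using \<open>\<rho>1 \<in> divergent_sequences\<close> \<open>\<rho>2 \<in> divergent_sequences\<close>
    by (intro bexI[of _ \<rho>1] bexI[of _ \<rho>2] bexI[of _ "(v0, v1)"]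
        bexI[of _ "(u0 - v0, u1 - v1)"]) auto
qed

end
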